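(* For every $x \in B_{c_0}$, we have $dc(x)=1$.
   Context: $c_0$ is the real Banach space of null sequences with the supremum norm. For a real Banach space $X$, $B_X$, $S_X$, $X^*$ denote the closed unit ball, unit sphere and topological dual. A slice of $B_X$ is a set $S(x^*,\delta)=\{y\in B_X : x^*(y)>1-\delta\}$ with $x^*\in S_{X^*}$ and $\delta>0$. For $x\in B_X$, the Daugavet constant $dc(x)$ is the supremum of all $\alpha\ge 0$ such that for all $\varepsilon,\delta>0$ and all $y^*\in S_{X^*}$ there exists $y\in S(y^*,\delta)$ with $\|y-x\|>\alpha-\varepsilon$. *)

theory Defs
  imports "HOL-Analysis.Analysis"
begin

section \<open>The Banach space of real null sequences\<close>

typedef c0 = "{f :: nat \<Rightarrow> real. f \<longlonglongrightarrow> 0}"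
  morphisms c0_nth Abs_c0
  by (rule exI[of _ "\<lambda>_. 0"]) simp

setup_lifting type_definition_c0

lemma c0_nth_null: "c0_nth f \<longlonglongrightarrow> 0"
  using c0_nth by auto

lemma c0_eqI: "(\<And>n. c0_nth f n = c0_nth g n) \<Longrightarrow> f = g"
  by (metis c0_nth_inject ext)

lemma bdd_above_c0_nth: "bdd_above (range (\<lambda>n. \<bar>c0_nth f n\<bar>))"
proof -
  have "Bseq (c0_nth f)"
    using c0_nth_null convergent_def convergent_imp_Bseq by blast
  then show ?thesis
    by (auto simp: Bseq_def bdd_above_def)
qed

instantiation c0 :: real_vector
begin

lift_definition zero_c0 :: c0 is "\<lambda>_. 0"
  by simp

lift_definition plus_c0 :: "c0 \<Rightarrow> c0 \<Rightarrow> c0" is "\<lambda>f g n. f n + g n"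
  using tendsto_add by fastforce

lift_definition minus_c0 :: "c0 \<Rightarrow> c0 \<Rightarrow> c0" is "\<lambda>f g n. f n - g n"
  using tendsto_diff by fastforce

lift_definition uminus_c0 :: "c0 \<Rightarrow> c0" is "\<lambda>f n. - f n"
  using tendsto_minus by fastforce

lift_definition scaleR_c0 :: "real \<Rightarrow> c0 \<Rightarrow> c0" is "\<lambda>r f n. r * f n"
  by (rule tendsto_mult_right_zero)

instance
  by standard (transfer; simp add: fun_eq_iff algebra_simps)+

end

instantiation c0 :: real_normed_vector
begin

definition norm_c0 :: "c0 \<Rightarrow> real"
  where "norm_c0 f = (SUP n. \<bar>c0_nth f n\<bar>)"

definition dist_c0 :: "c0 \<Rightarrow> c0 \<Rightarrow> real"
  where "dist_c0 f g = norm (f - g)"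

definition sgn_c0 :: "c0 \<Rightarrow> c0"
  where "sgn_c0 f = f /\<^sub>R norm f"

definition uniformity_c0 :: "(c0 \<times> c0) filter"
  where "uniformity_c0 = (INF e\<in>{0<..}. principal {(f, g). dist f g < e})"

definition open_c0 :: "c0 set \<Rightarrow> bool"
  where "open_c0 U = (\<forall>f\<in>U. \<forall>\<^sub>F (f', g) in uniformity. f' = f \<longrightarrow> g \<in> U)"

lemma abs_c0_nth_le_norm: "\<bar>c0_nth f n\<bar> \<le> norm f"
  unfolding norm_c0_def by (rule cSUP_upper[OF UNIV_I bdd_above_c0_nth])

lemma norm_c0_le: "(\<And>n. \<bar>c0_nth f n\<bar> \<le> B) \<Longrightarrow> norm f \<le> B"
  unfolding norm_c0_def by (rule cSUP_least) auto

instance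
proof
  fix f g :: c0 and r :: real
  show "(norm f = 0) = (f = 0)"
  proof
    assume "norm f = 0"
    then have "c0_nth f n = 0" for n
      using abs_c0_nth_le_norm[of f n] by simp
    then show "f = 0"
      by (auto intro!: c0_eqI simp: zero_c0.rep_eq)
  qed (simp add: norm_c0_def zero_c0.rep_eq)
  show "norm (f + g) \<le> norm f + norm g"
  proof (rule norm_c0_le)
    fix n
    show "\<bar>c0_nth (f + g) n\<bar> \<le> norm f + norm g"
      using abs_c0_nth_le_norm[of f n] abs_c0_nth_le_norm[of g n]
      by (simp add: plus_c0.rep_eq)
  qed
  have le: "norm (s *\<^sub>R h) \<le> \<bar>s\<bar> * norm h" for s and h :: c0
    by (rule norm_c0_le)
      (simp add: scaleR_c0.rep_eq abs_mult abs_c0_nth_le_norm mult_left_mono)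
  show "norm (r *\<^sub>R f) = \<bar>r\<bar> * norm f"
  proof (cases "r = 0")
    case True
    then show ?thesis
      by (simp add: norm_c0_def zero_c0.rep_eq)
  next
    case False
    have "norm f \<le> \<bar>inverse r\<bar> * norm (r *\<^sub>R f)"
      using le[of "inverse r" "r *\<^sub>R f"] False by simp
    then show ?thesis
      using le[of r f] False by (simp add: field_simps)
  qed
qed (simp_all add: dist_c0_def sgn_c0_def uniformity_c0_def open_c0_def)

end

instance c0 :: banach
proof
  fix X :: "nat \<Rightarrow> c0"
  assume X: "Cauchy X"
  have nth_dist: "dist (c0_nth f n) (c0_nth g n) \<le> dist f g" for f g :: c0 and n
    using abs_c0_nth_le_norm[of "f - g" n]
    by (simp add: dist_norm minus_c0.rep_eq)
  have "uniformly_Cauchy_on UNIV (\<lambda>k. c0_nth (X k))"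
    unfolding uniformly_Cauchy_on_def
    using X nth_dist by (meson Cauchy_def le_less_trans)
  then obtain l where l: "uniform_limit UNIV (\<lambda>k. c0_nth (X k)) l sequentially"
    using Cauchy_uniformly_convergent uniformly_convergent_on_def by blast
  have "l \<longlonglongrightarrow> 0"
    by (rule swap_uniform_limit'[OF _ _ l])
      (auto simp: c0_nth_null intro: tendsto_const)
  then obtain L where L: "c0_nth L = l"
    using Abs_c0_inverse by blast
  have "X \<longlonglongrightarrow> L"
  proof (rule metric_LIMSEQ_I)
    fix e :: real
    assume "0 < e"
    then obtain N where N: "\<And>k n. k \<ge> N \<Longrightarrow> dist (c0_nth (X k) n) (l n) < e / 2"
      using l[unfolded uniform_limit_iff eventually_sequentially, rule_format, of "e / 2"]
      by auto
    have "dist (X k) L < e" if "k \<ge> N" for k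
    proof -
      have "norm (X k - L) \<le> e / 2"
        by (rule norm_c0_le)
          (use N[OF that] in \<open>simp add: L minus_c0.rep_eq dist_real_def less_imp_le\<close>)
      then show ?thesis
        using \<open>0 < e\<close> by (simp add: dist_norm)
    qed
    then show "\<exists>N. \<forall>k\<ge>N. dist (X k) L < e"
      by blast
  qed
  then show "convergent X"
    by (rule convergentI)
qed


section \<open>Slices and the Daugavet constant\<close>

text \<open>The dual of a real normed space is the type of bounded linear maps into
  \<open>real\<close> with the operator norm.\<close>

definition slice :: "('a::banach \<Rightarrow>\<^sub>L real) \<Rightarrow> real \<Rightarrow> 'a set"
  where "slice f \<delta> = {y \<in> cball 0 1. blinfun_apply f y > 1 - \<delta>}"

text \<open>The supremum is taken in \<open>real\<close>. For \<open>x\<close> in the unit ball of a nontrivial space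
  the set contains \<open>0\<close> and is bounded above by \<open>2\<close>, so this is the true supremum; in the
  trivial space the dual unit sphere is empty and the value is meaningless.\<close>

definition daugavet_const :: "'a::banach \<Rightarrow> real"
  where "daugavet_const x =
    Sup {\<alpha>. \<alpha> \<ge> 0 \<and>
      (\<forall>\<epsilon>>0. \<forall>\<delta>>0. \<forall>f \<in> sphere (0 :: 'a \<Rightarrow>\<^sub>L real) 1.
         \<exists>y \<in> slice f \<delta>. norm (y - x) > \<alpha> - \<epsilon>)}"

end

theory Submission
  imports Defs
begin

text \<open>Lower bound: given \<open>y\<close> in a slice, replace a coordinate \<open>y\<^sub>n\<close> with \<open>n\<close> large by \<open>1\<close> or
  \<open>-1\<close>. As \<open>y\<^sub>n\<close> is a convex combination of \<open>\<plusminus>1\<close>, one of the two choices does not decrease the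
  functional; as \<open>x\<^sub>n\<close> is almost \<open>0\<close>, both are almost at distance \<open>1\<close> from \<open>x\<close>.

  Upper bound: if \<open>\<bar>x\<^sub>k\<bar> < \<epsilon>\<close> for \<open>k \<ge> K\<close>, average the coordinates \<open>k < K\<close>
  with the signs of \<open>x\<^sub>k\<close>. In a thin slice of this functional, each \<open>y\<^sub>k\<close> with
  \<open>k < K\<close> is almost the sign of \<open>x\<^sub>k\<close>, so no point of the slice is much further than \<open>1\<close> from \<open>x\<close>.\<close>

text \<open>If \<open>f\<close> were at most 1 - \<delta> on the whole unit ball, applying this to
  both signs of a normalised vector would bound the operator norm by 1 - \<delta>.\<close>

lemma slice_nonempty:
  fixes f :: "'a::banach \<Rightarrow>\<^sub>L real"
  assumes "norm f = 1" and "\<delta> > 0"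
  obtains y where "y \<in> slice f \<delta>"
proof (rule ccontr)
  assume "\<not> thesis"
  with that have le: "blinfun_apply f y \<le> 1 - \<delta>" if "norm y \<le> 1" for y
    using \<open>norm y \<le> 1\<close> by (fastforce simp: slice_def)
  \<comment> \<open>Nonnegativity of the constant is a premise of
    \<open>norm_blinfun_bound\<close>.\<close>
  have "0 \<le> 1 - \<delta>"
    using le[of 0] by (simp add: blinfun.zero_right)
  moreover have "norm (blinfun_apply f z) \<le> (1 - \<delta>) * norm z" for z
  proof (cases "z = 0")
    case False
    let ?u = "z /\<^sub>R norm z"
    have "norm ?u \<le> 1" "norm (- ?u) \<le> 1"
      using False by simp_all
    from this[THEN le] have "\<bar>blinfun_apply f z\<bar> / norm z \<le> 1 - \<delta>"
      by (simp add: blinfun.minus_right blinfun.scaleR_right divide_inverse abs_if mult.commute)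
    then show ?thesis
      using False by (simp add: field_simps)
  qed (simp add: blinfun.zero_right)
  ultimately have "norm f \<le> 1 - \<delta>"
    by (intro norm_blinfun_bound) auto
  with assms show False by simp
qed

lift_definition c0_upd :: "c0 \<Rightarrow> nat \<Rightarrow> real \<Rightarrow> c0" is "\<lambda>f n t. f(n := t)"
proof -
  fix f :: "nat \<Rightarrow> real" and n t
  assume "f \<longlonglongrightarrow> 0"
  moreover have "\<forall>\<^sub>F k in sequentially. f k = (f(n := t)) k"
    by (rule eventually_sequentiallyI[of "Suc n"]) simp
  ultimately show "f(n := t) \<longlonglongrightarrow> 0"
    by (rule Lim_transform_eventually)
qed

lemma norm_c0_upd_le:
  assumes "norm y \<le> B" and "\<bar>t\<bar> \<le> B"
  shows "norm (c0_upd y n t) \<le> B"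
  using assms abs_c0_nth_le_norm[of y]
  by (intro norm_c0_le) (auto simp: c0_upd.rep_eq intro: order_trans)

lemma convex_combination_c0_upd:
  "2 *\<^sub>R y = (1 + c0_nth y n) *\<^sub>R c0_upd y n 1 + (1 - c0_nth y n) *\<^sub>R c0_upd y n (-1)"
  by (rule c0_eqI, unfold plus_c0.rep_eq scaleR_c0.rep_eq c0_upd.rep_eq) (simp add: algebra_simps)

lemma slice_c0_far_point:
  fixes f :: "c0 \<Rightarrow>\<^sub>L real" and x :: c0
  assumes "norm f = 1" and "\<delta> > 0" and "\<epsilon> > 0"
  shows "\<exists>y \<in> slice f \<delta>. norm (y - x) > 1 - \<epsilon>"
proof -
  obtain y where y: "norm y \<le> 1" "blinfun_apply f y > 1 - \<delta>"
    using slice_nonempty[OF assms(1,2)] by (auto simp: slice_def)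
  obtain n where n: "\<bar>c0_nth x n\<bar> < \<epsilon>"
    using LIMSEQ_D[OF c0_nth_null \<open>\<epsilon> > 0\<close>, of x] by auto
  let ?a = "c0_nth y n" and ?p = "c0_upd y n 1" and ?q = "c0_upd y n (-1)"
  have a: "\<bar>?a\<bar> \<le> 1"
    using abs_c0_nth_le_norm y(1) by (rule order_trans)
  have comb: "2 * blinfun_apply f y
      = (1 + ?a) * blinfun_apply f ?p + (1 - ?a) * blinfun_apply f ?q"
    using arg_cong[OF convex_combination_c0_upd[of y n], of "blinfun_apply f"]
    by (simp add: blinfun.add_right blinfun.scaleR_right)
  \<comment> \<open>The weights \<open>1 + ?a\<close> and \<open>1 - ?a\<close> are nonnegative and
    sum to 2.\<close>
  have "blinfun_apply f ?p > 1 - \<delta> \<or> blinfun_apply f ?q > 1 - \<delta>"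
  proof (rule ccontr)
    assume "\<not> ?thesis"
    then have "(1 + ?a) * blinfun_apply f ?p \<le> (1 + ?a) * (1 - \<delta>)"
      and "(1 - ?a) * blinfun_apply f ?q \<le> (1 - ?a) * (1 - \<delta>)"
      using a by (auto intro!: mult_left_mono)
    with comb y(2) show False
      by (simp add: algebra_simps)
  qed
  then obtain t :: real where t: "\<bar>t\<bar> = 1" "blinfun_apply f (c0_upd y n t) > 1 - \<delta>"
    by (metis abs_minus_cancel abs_one)
  have "c0_upd y n t \<in> slice f \<delta>"
    using t y(1) by (simp add: slice_def norm_c0_upd_le)
  moreover have "norm (c0_upd y n t - x) > 1 - \<epsilon>"
    using abs_c0_nth_le_norm[of "c0_upd y n t - x" n] n t(1)
    by (simp add: minus_c0.rep_eq c0_upd.rep_eq)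
  ultimately show ?thesis by blast
qed

lift_definition c0_trunc :: "nat \<Rightarrow> (nat \<Rightarrow> real) \<Rightarrow> c0" is "\<lambda>K s k. if k < K then s k else 0"
proof -
  fix K and s :: "nat \<Rightarrow> real"
  show "(\<lambda>k. if k < K then s k else 0) \<longlonglongrightarrow> 0"
    by (rule tendsto_eventually, rule eventually_sequentiallyI[of K]) simp
qed

text \<open>An average of \<open>K\<close> terms, each at most \<open>norm y\<close> in absolute
  value, has norm at most 1; the sign sequence cut off at \<open>K\<close> attains the value
  1.\<close>

lemma norm_one_signed_average:
  fixes s :: "nat \<Rightarrow> real"
  assumes "K > 0" and s: "\<And>k. \<bar>s k\<bar> = 1"
  obtains f :: "c0 \<Rightarrow>\<^sub>L real" where "norm f = 1"
    and "\<And>y. blinfun_apply f y = (\<Sum>k<K. s k * c0_nth y k) / K"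
proof -
  define F where "F y = (\<Sum>k<K. s k * c0_nth y k) / K" for y
  have F_le: "norm (F y) \<le> norm y" for y
  proof -
    have "\<bar>\<Sum>k<K. s k * c0_nth y k\<bar> \<le> (\<Sum>k<K. norm y)"
      by (rule order_trans[OF sum_abs])
        (intro sum_mono, simp add: abs_mult s abs_c0_nth_le_norm)
    then show ?thesis
      using \<open>K > 0\<close> by (simp add: F_def field_simps)
  qed
  have "bounded_linear F"
  proof (rule bounded_linear_intro[where K = 1])
    show "F (y + z) = F y + F z" for y z
      by (simp add: F_def plus_c0.rep_eq algebra_simps sum.distrib add_divide_distrib)
    show "F (r *\<^sub>R y) = r *\<^sub>R F y" for r y
      by (simp add: F_def scaleR_c0.rep_eq sum_distrib_left mult.left_commute)
  qed (simp add: F_le[simplified])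
  then have apply_F: "blinfun_apply (Blinfun F) = F"
    by (rule bounded_linear_Blinfun_apply)
  let ?u = "c0_trunc K s"
  have "norm ?u \<le> 1"
    by (rule norm_c0_le) (simp add: c0_trunc.rep_eq s)
  moreover have "F ?u = 1"
  proof -
    have "s k * s k = 1" for k
      using s[of k] by (metis abs_mult_self_eq mult_1)
    then show ?thesis
      using \<open>K > 0\<close> by (simp add: F_def c0_trunc.rep_eq)
  qed
  ultimately have "1 \<le> norm (Blinfun F)"
    using norm_blinfun[of "Blinfun F" ?u] mult_left_le[OF _ norm_ge_zero, of "norm ?u" "Blinfun F"]
    by (simp add: apply_F)
  moreover have "norm (Blinfun F) \<le> 1"
    by (rule norm_blinfun_bound) (simp_all add: apply_F F_le[simplified])
  ultimately show thesis
    using that[of "Blinfun F"] by (simp add: apply_F F_def)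
qed

text \<open>The other terms contribute at most \<open>card A - 1\<close>, so no single term can fall
  short of 1 by the whole deficit \<epsilon>.\<close>

lemma sum_gt_card_minus_imp_gt:
  fixes a :: "'a \<Rightarrow> real" and \<epsilon> :: real
  assumes "finite A" and "\<And>i. i \<in> A \<Longrightarrow> a i \<le> 1"
    and "sum a A > card A - \<epsilon>" and "j \<in> A"
  shows "a j > 1 - \<epsilon>"
proof -
  have "sum a (A - {j}) \<le> (\<Sum>i\<in>A - {j}. 1)"
    using assms(2) by (intro sum_mono) simp
  moreover have "card A = Suc (card (A - {j}))"
    using assms(1,4) by (rule card.remove)
  ultimately show ?thesis
    using assms(3) sum.remove[OF assms(1,4), of a] by simp
qed

lemma exists_slice_c0_near:
  fixes x :: c0
  assumes "norm x \<le> 1" and "\<epsilon> > 0"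
  obtains f :: "c0 \<Rightarrow>\<^sub>L real" and \<delta> where "norm f = 1" and "\<delta> > 0"
    and "\<And>y. y \<in> slice f \<delta> \<Longrightarrow> norm (y - x) \<le> 1 + \<epsilon>"
proof -
  obtain N where N: "\<And>k. k \<ge> N \<Longrightarrow> \<bar>c0_nth x k\<bar> < \<epsilon>"
    using LIMSEQ_D[OF c0_nth_null \<open>\<epsilon> > 0\<close>, of x] by auto
  \<comment> \<open>The successor keeps \<open>K\<close> positive, as the average divides by
    it.\<close>
  define K where "K = Suc N"
  \<comment> \<open>Not \<^const>\<open>sgn\<close>, which vanishes where \<open>x\<close> does.\<close>
  define s :: "nat \<Rightarrow> real" where "s k = (if c0_nth x k \<ge> 0 then 1 else -1)" for k
  obtain f :: "c0 \<Rightarrow>\<^sub>L real" where f: "norm f = 1"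
      "\<And>y. blinfun_apply f y = (\<Sum>k<K. s k * c0_nth y k) / K"
    by (rule norm_one_signed_average[of K s]) (auto simp: K_def s_def)
  \<comment> \<open>A deficit \<epsilon> / K in the average is a deficit \<epsilon> in the
    sum.\<close>
  have "norm (y - x) \<le> 1 + \<epsilon>" if y: "y \<in> slice f (\<epsilon> / K)" for y
  proof (rule norm_c0_le)
    fix k
    have y1: "\<bar>c0_nth y i\<bar> \<le> 1" for i
      using y abs_c0_nth_le_norm[of y i] by (simp add: slice_def)
    have x1: "\<bar>c0_nth x k\<bar> \<le> 1"
      using abs_c0_nth_le_norm assms(1) by (rule order_trans)
    show "\<bar>c0_nth (y - x) k\<bar> \<le> 1 + \<epsilon>"
    proof (cases "k < K")
      case True
      have "(K - \<epsilon>) / K < (\<Sum>i<K. s i * c0_nth y i) / K"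
        using y True by (simp add: slice_def f(2) diff_divide_distrib)
      then have "(\<Sum>i<K. s i * c0_nth y i) > K - \<epsilon>"
        using True by (simp add: divide_less_cancel)
      moreover have "s i * c0_nth y i \<le> 1" for i
        using y1[of i] by (auto simp: s_def)
      ultimately have "s k * c0_nth y k > 1 - \<epsilon>"
        using True sum_gt_card_minus_imp_gt[of "{..<K}" "\<lambda>i. s i * c0_nth y i" \<epsilon> k] by simp
      \<comment> \<open>Here \<open>s k * c0_nth y k\<close> lies in (1 - \<epsilon>, 1] and
        \<open>s k * c0_nth x k\<close> in [0, 1], so their difference lies in (-\<epsilon>,
        1].\<close>
      then show ?thesis
        using x1 y1[of k] \<open>\<epsilon> > 0\<close> by (auto simp: minus_c0.rep_eq s_def split: if_splits)
    next
      case False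
      then show ?thesis
        using N[of k] y1[of k] by (simp add: minus_c0.rep_eq K_def)
    qed
  qed
  moreover have "\<epsilon> / K > 0"
    using \<open>\<epsilon> > 0\<close> by (simp add: K_def)
  ultimately show thesis
    using that f(1) by blast
qed

theorem proposition3p2:
  fixes x :: c0
  assumes "x \<in> cball 0 1"
  shows "daugavet_const x = 1"
  unfolding daugavet_const_def
proof (rule cSup_eq_maximum, goal_cases)
  case 1
  show ?case
    using slice_c0_far_point by simp
next
  case (2 \<alpha>)
  show ?case
  proof (rule field_le_epsilon)
    fix e :: real
    assume "e > 0"
    \<comment> \<open>One half of \<open>e\<close> pays for the radius of the near slice, the other
      for the slack in the definition of the constant.\<close>
    then have e: "e / 2 > 0" by simp
    obtain f :: "c0 \<Rightarrow>\<^sub>L real" and \<delta> where f: "norm f = 1" "\<delta> > 0"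
        and near: "\<And>y. y \<in> slice f \<delta> \<Longrightarrow> norm (y - x) \<le> 1 + e / 2"
      using exists_slice_c0_near[OF _ e, of x] assms by auto
    then obtain y where "y \<in> slice f \<delta>" "norm (y - x) > \<alpha> - e / 2"
      using 2 e f by fastforce
    with near[of y] show "\<alpha> \<le> 1 + e" by simp
  qed
qed

end
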